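(* Let $X=\operatorname{Spec}(A)$ be a normal affine variety over $\mathbb{C}$ with an effective action of a torus $T$ with character lattice $M$, let $T'\subset T$ be a subtorus with character lattice $M'$, acting on $X$ by restriction, and let $i:M\to M'$ be the surjective lattice homomorphism induced by the inclusion $T'\subset T$ (also denoting the induced map $M_{\mathbb{Q}}\to M'_{\mathbb{Q}}$). Then: 1. If $\omega_T$ and $\omega_{T'}$ are the weight cones associated with the $T$-action and the $T'$-action respectively, then $i(\omega_T)=\omega_{T'}$. Moreover, for every point $x\in X$: 2. If $\omega_T(x)$ and $\omega_{T'}(x)$ are the orbit cones of $x$ associated with the $T$-action and the $T'$-action respectively, then $i(\omega_T(x))=\omega_{T'}(x)$. 3. If $S_T(x)$ and $S_{T'}(x)$ are the orbit monoids of $x$ associated with the $T$-action and the $T'$-action respectively, then $i(S_T(x))=S_{T'}(x)$.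
   Context: The $T$-action corresponds to a grading $A=\bigoplus_{u\in M}A_u$, and the $T'$-action to the grading $A=\bigoplus_{v\in M'}A_v$ with $A_v=\bigoplus_{u\in M,\ i(u)=v}A_u$. For a torus $T$ with character lattice $M$ acting on $X=\operatorname{Spec}(A)$ (and likewise for $T'$, $M'$): the weight cone $\omega_T\subset M_{\mathbb{Q}}$ is the cone generated by all $u\in M$ with $A_u\neq\{0\}$. The orbit monoid of $x\in X$ is the submonoid $S_T(x)\subset M$ of all $u\in M$ admitting $f\in A_u$ with $f(x)\neq0$. The orbit cone $\omega_T(x)\subset M_{\mathbb{Q}}$ is the convex cone generated by $S_T(x)$. *)

theory Defs
  imports Complex_Main "HOL-Algebra.Group_Action" "HOL-Algebra.Product_Groups"
begin

section \<open>Affine varieties over the complex numbers\<close>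

text \<open>
  An affine variety is given by its set \<open>X\<close> of (closed) points together with its algebra
  \<open>A\<close> of regular functions. Functions on \<open>X\<close> are represented as elements of
  \<^term>\<open>extensional X\<close>, so that equality in \<open>A\<close> is equality of functions on \<open>X\<close>.
\<close>

inductive_set generated_algebra :: "'x set \<Rightarrow> ('x \<Rightarrow> complex) set \<Rightarrow> ('x \<Rightarrow> complex) set"
  for X :: "'x set" and F :: "('x \<Rightarrow> complex) set" where
  const: "(\<lambda>x\<in>X. c) \<in> generated_algebra X F"
| gen: "f \<in> F \<Longrightarrow> restrict f X \<in> generated_algebra X F"
| add: "f \<in> generated_algebra X F \<Longrightarrow> g \<in> generated_algebra X F
    \<Longrightarrow> (\<lambda>x\<in>X. f x + g x) \<in> generated_algebra X F"
| mult: "f \<in> generated_algebra X F \<Longrightarrow> g \<in> generated_algebra X F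
    \<Longrightarrow> (\<lambda>x\<in>X. f x * g x) \<in> generated_algebra X F"

definition algebra_hom_to_complex ::
    "'x set \<Rightarrow> ('x \<Rightarrow> complex) set \<Rightarrow> (('x \<Rightarrow> complex) \<Rightarrow> complex) \<Rightarrow> bool" where
  "algebra_hom_to_complex X A \<psi> \<longleftrightarrow>
     (\<forall>c. \<psi> (\<lambda>x\<in>X. c) = c) \<and>
     (\<forall>f\<in>A. \<forall>g\<in>A. \<psi> (\<lambda>x\<in>X. f x + g x) = \<psi> f + \<psi> g) \<and>
     (\<forall>f\<in>A. \<forall>g\<in>A. \<psi> (\<lambda>x\<in>X. f x * g x) = \<psi> f * \<psi> g)"

text \<open>
  \<open>X = Spec A\<close> for a finitely generated integral domain \<open>A\<close> over the complex numbers: by the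
  Nullstellensatz the closed points of \<open>Spec A\<close> are the algebra homomorphisms from \<open>A\<close> to the
  complex numbers, and these are required to be exactly the evaluations at the points of \<open>X\<close>.
\<close>

definition affine_variety :: "'x set \<Rightarrow> ('x \<Rightarrow> complex) set \<Rightarrow> bool" where
  "affine_variety X A \<longleftrightarrow>
     (\<exists>F. finite F \<and> A = generated_algebra X F) \<and>
     (\<forall>\<psi>. algebra_hom_to_complex X A \<psi> \<longrightarrow> (\<exists>!x. x \<in> X \<and> (\<forall>f\<in>A. \<psi> f = f x))) \<and>
     X \<noteq> {} \<and>
     (\<forall>f\<in>A. \<forall>g\<in>A. (\<forall>x\<in>X. f x * g x = 0) \<longrightarrow> (\<forall>x\<in>X. f x = 0) \<or> (\<forall>x\<in>X. g x = 0))"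

text \<open>
  \<open>A\<close> is integrally closed in its field of fractions. An element \<open>f / g\<close> of the fraction field is
  treated as a function on the non-empty, hence dense, open set where \<open>g\<close> does not vanish; for an
  affine variety, two fractions are equal iff they agree on such a set.
\<close>

definition normal_affine_variety :: "'x set \<Rightarrow> ('x \<Rightarrow> complex) set \<Rightarrow> bool" where
  "normal_affine_variety X A \<longleftrightarrow> affine_variety X A \<and>
     (\<forall>f\<in>A. \<forall>g\<in>A. (\<exists>x\<in>X. g x \<noteq> 0) \<longrightarrow>
        (\<exists>(n::nat) a. (\<forall>k<n. a k \<in> A) \<and>
           (\<forall>x\<in>X. g x \<noteq> 0 \<longrightarrow> (f x / g x) ^ n + (\<Sum>k<n. a k x * (f x / g x) ^ k) = 0)) \<longrightarrow>
        (\<exists>h\<in>A. \<forall>x\<in>X. g x \<noteq> 0 \<longrightarrow> f x / g x = h x))"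

definition regular_map ::
    "'x set \<Rightarrow> ('x \<Rightarrow> complex) set \<Rightarrow> 'y set \<Rightarrow> ('y \<Rightarrow> complex) set \<Rightarrow> ('x \<Rightarrow> 'y) \<Rightarrow> bool" where
  "regular_map X A Y B \<phi> \<longleftrightarrow> \<phi> \<in> X \<rightarrow> Y \<and> (\<forall>g\<in>B. compose X g \<phi> \<in> A)"

text \<open>The image of the tensor product of \<open>A\<close> and \<open>B\<close> in the functions on \<open>X \<times> Y\<close>.\<close>

definition product_algebra ::
    "'x set \<Rightarrow> ('x \<Rightarrow> complex) set \<Rightarrow> 'y set \<Rightarrow> ('y \<Rightarrow> complex) set \<Rightarrow> ('x \<times> 'y \<Rightarrow> complex) set" where
  "product_algebra X A Y B =
     generated_algebra (X \<times> Y) ((\<lambda>f. f \<circ> fst) ` A \<union> (\<lambda>g. g \<circ> snd) ` B)"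


section \<open>Tori and their characters\<close>

definition complex_units :: "complex monoid" where
  "complex_units = \<lparr>carrier = UNIV - {0}, monoid.mult = (*), one = 1\<rparr>"

definition std_torus :: "nat \<Rightarrow> (nat \<Rightarrow> complex) monoid" where
  "std_torus n = product_group {..<n} (\<lambda>_. complex_units)"

definition laurent_polynomials :: "nat \<Rightarrow> ((nat \<Rightarrow> complex) \<Rightarrow> complex) set" where
  "laurent_polynomials n = generated_algebra (carrier (std_torus n))
     ((\<lambda>i t. t i) ` {..<n} \<union> (\<lambda>i t. inverse (t i)) ` {..<n})"

text \<open>
  A torus is a group \<open>T\<close> with an algebra \<open>R\<close> of regular functions which is isomorphic, as an
  algebraic group, to a standard torus.
\<close>

definition torus :: "('t, 'b) monoid_scheme \<Rightarrow> ('t \<Rightarrow> complex) set \<Rightarrow> bool" where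
  "torus T R \<longleftrightarrow> group T \<and> R \<subseteq> extensional (carrier T) \<and>
     (\<exists>n. \<exists>\<phi> \<in> iso (std_torus n) T.
        (\<lambda>g. compose (carrier (std_torus n)) g \<phi>) ` R = laurent_polynomials n)"

definition restrict_algebra :: "('t \<Rightarrow> complex) set \<Rightarrow> 't set \<Rightarrow> ('t \<Rightarrow> complex) set" where
  "restrict_algebra R H = (\<lambda>g. restrict g H) ` R"

definition subtorus ::
    "'t set \<Rightarrow> ('t, 'b) monoid_scheme \<Rightarrow> ('t \<Rightarrow> complex) set \<Rightarrow> bool" where
  "subtorus H T R \<longleftrightarrow> subgroup H T \<and>
     (\<exists>I\<subseteq>R. H = {t \<in> carrier T. \<forall>g\<in>I. g t = 0}) \<and>
     torus (T\<lparr>carrier := H\<rparr>) (restrict_algebra R H)"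

definition characters ::
    "('t, 'b) monoid_scheme \<Rightarrow> ('t \<Rightarrow> complex) set \<Rightarrow> ('t \<Rightarrow> complex) set" where
  "characters T R = hom T complex_units \<inter> R"

text \<open>
  A lattice \<open>M\<close> together with \<open>M\<^sub>Q\<close>: the type \<open>'v\<close> is a finite-dimensional rational vector space,
  and \<open>M\<close> consists of the integral combinations of one of its bases, so that \<open>'v\<close> is the tensor
  product of \<open>M\<close> with the rationals.
\<close>

definition full_lattice :: "(rat \<Rightarrow> 'v::ab_group_add \<Rightarrow> 'v) \<Rightarrow> 'v set \<Rightarrow> bool" where
  "full_lattice sc M \<longleftrightarrow>
     (\<exists>B. finite_dimensional_vector_space sc B \<and>
          M = {\<Sum>b\<in>B. sc (of_int (k b)) b |k :: 'v \<Rightarrow> int. True})"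

text \<open>
  The additive lattice \<open>M\<close> is identified with the multiplicative group of characters of \<open>T\<close>
  by \<open>u \<mapsto> \<chi> u\<close>.
\<close>

definition character_lattice ::
    "(rat \<Rightarrow> 'v::ab_group_add \<Rightarrow> 'v) \<Rightarrow> 'v set \<Rightarrow> ('v \<Rightarrow> 't \<Rightarrow> complex) \<Rightarrow>
     ('t, 'b) monoid_scheme \<Rightarrow> ('t \<Rightarrow> complex) set \<Rightarrow> bool" where
  "character_lattice sc M \<chi> T R \<longleftrightarrow> full_lattice sc M \<and>
     bij_betw \<chi> M (characters T R) \<and>
     (\<forall>u\<in>M. \<forall>v\<in>M. \<forall>t\<in>carrier T. \<chi> (u + v) t = \<chi> u t * \<chi> v t)"

text \<open>
  The map on character lattices induced by an inclusion of a subtorus \<open>H\<close>, i.e. restriction of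
  characters, extended linearly to the rational vector spaces.
\<close>

definition induced_lattice_hom ::
    "(rat \<Rightarrow> 'v::ab_group_add \<Rightarrow> 'v) \<Rightarrow> 'v set \<Rightarrow> ('v \<Rightarrow> 't \<Rightarrow> complex) \<Rightarrow>
     (rat \<Rightarrow> 'w::ab_group_add \<Rightarrow> 'w) \<Rightarrow> 'w set \<Rightarrow> ('w \<Rightarrow> 't \<Rightarrow> complex) \<Rightarrow>
     't set \<Rightarrow> ('v \<Rightarrow> 'w) \<Rightarrow> bool" where
  "induced_lattice_hom sc M \<chi> sc' M' \<chi>' H i \<longleftrightarrow> Vector_Spaces.linear sc sc' i \<and>
     (\<forall>u\<in>M. i u \<in> M' \<and> \<chi>' (i u) = restrict (\<chi> u) H)"


section \<open>Torus actions, weight cones, orbit cones and orbit monoids\<close>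

definition regular_action ::
    "('t, 'b) monoid_scheme \<Rightarrow> ('t \<Rightarrow> complex) set \<Rightarrow> 'x set \<Rightarrow> ('x \<Rightarrow> complex) set \<Rightarrow>
     ('t \<Rightarrow> 'x \<Rightarrow> 'x) \<Rightarrow> bool" where
  "regular_action T R X A \<alpha> \<longleftrightarrow> group_action T X \<alpha> \<and>
     regular_map (carrier T \<times> X) (product_algebra (carrier T) R X A) X A (\<lambda>(t, x). \<alpha> t x)"

text \<open>
  The homogeneous component \<open>A\<^sub>u\<close> of the grading corresponding to an action, where \<open>\<xi>\<close> is the
  character of weight \<open>u\<close>. Only the elements of \<open>carrier T\<close> are used, so replacing \<open>T\<close> by
  \<open>T\<lparr>carrier := H\<rparr>\<close> amounts to restricting the action to \<open>H\<close>.
\<close>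

definition weight_space ::
    "('t, 'b) monoid_scheme \<Rightarrow> 'x set \<Rightarrow> ('x \<Rightarrow> complex) set \<Rightarrow> ('t \<Rightarrow> 'x \<Rightarrow> 'x) \<Rightarrow>
     ('t \<Rightarrow> complex) \<Rightarrow> ('x \<Rightarrow> complex) set" where
  "weight_space T X A \<alpha> \<xi> = {f \<in> A. \<forall>t\<in>carrier T. \<forall>x\<in>X. f (\<alpha> t x) = \<xi> t * f x}"

definition rational_cone :: "(rat \<Rightarrow> 'v::ab_group_add \<Rightarrow> 'v) \<Rightarrow> 'v set \<Rightarrow> 'v set" where
  "rational_cone sc S =
     {\<Sum>s\<in>F. sc (c s) s |F c. finite F \<and> F \<subseteq> S \<and> (\<forall>s\<in>F. (0::rat) \<le> c s)}"

definition weight_cone ::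
    "(rat \<Rightarrow> 'v::ab_group_add \<Rightarrow> 'v) \<Rightarrow> 'v set \<Rightarrow> ('v \<Rightarrow> 't \<Rightarrow> complex) \<Rightarrow>
     ('t, 'b) monoid_scheme \<Rightarrow> 'x set \<Rightarrow> ('x \<Rightarrow> complex) set \<Rightarrow> ('t \<Rightarrow> 'x \<Rightarrow> 'x) \<Rightarrow> 'v set" where
  "weight_cone sc M \<chi> T X A \<alpha> =
     rational_cone sc {u \<in> M. weight_space T X A \<alpha> (\<chi> u) \<noteq> {\<lambda>x\<in>X. 0}}"

definition orbit_monoid ::
    "'v set \<Rightarrow> ('v \<Rightarrow> 't \<Rightarrow> complex) \<Rightarrow>
     ('t, 'b) monoid_scheme \<Rightarrow> 'x set \<Rightarrow> ('x \<Rightarrow> complex) set \<Rightarrow> ('t \<Rightarrow> 'x \<Rightarrow> 'x) \<Rightarrow> 'x \<Rightarrow> 'v set" where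
  "orbit_monoid M \<chi> T X A \<alpha> x = {u \<in> M. \<exists>f \<in> weight_space T X A \<alpha> (\<chi> u). f x \<noteq> 0}"

definition orbit_cone ::
    "(rat \<Rightarrow> 'v::ab_group_add \<Rightarrow> 'v) \<Rightarrow> 'v set \<Rightarrow> ('v \<Rightarrow> 't \<Rightarrow> complex) \<Rightarrow>
     ('t, 'b) monoid_scheme \<Rightarrow> 'x set \<Rightarrow> ('x \<Rightarrow> complex) set \<Rightarrow> ('t \<Rightarrow> 'x \<Rightarrow> 'x) \<Rightarrow> 'x \<Rightarrow> 'v set" where
  "orbit_cone sc M \<chi> T X A \<alpha> x = rational_cone sc (orbit_monoid M \<chi> T X A \<alpha> x)"

end

theory Submission
  imports Defs
begin

text \<open>
  Everything rests on the orbit monoids. Restricting characters to the subtorus \<open>T'\<close> turns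
  an element of \<open>A\<^sub>u\<close> into an element of weight \<open>i u\<close>, so \<open>i\<close> maps \<open>S\<^sub>T(x)\<close> into
  \<open>S\<^sub>T\<^sub>'(x)\<close>. Conversely, let \<open>f\<close> have weight \<open>v\<close> for \<open>T'\<close>, with \<open>f(x) \<noteq> 0\<close>. Regular functions
  on a torus are linear combinations of characters (lemma \<open>regular_function_sum_of_characters\<close>), so
  regularity of the action gives a finite expansion
  \<open>f(t x) = (\<Sum>\<chi>\<in>C. \<chi>(t) f\<^sub>\<chi>(x))\<close> with coefficients \<open>f\<^sub>\<chi>\<close> in \<open>A\<close>, and linear independence of
  characters (lemma \<open>characters_independent\<close>) shows that each \<open>f\<^sub>\<chi>\<close> is homogeneous of weight \<open>\<chi>\<close>
  (lemma \<open>homogeneous_expansion\<close>). For \<open>t\<close> in \<open>T'\<close> the left-hand side is \<open>v(t) f(x)\<close>, a nonzero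
  multiple of the single character \<open>v\<close> of \<open>T'\<close>. Independence of characters, now on \<open>T'\<close>, forces some
  \<open>\<chi>\<close> in \<open>C\<close> to restrict to \<open>v\<close> and to satisfy \<open>f\<^sub>\<chi>(x) \<noteq> 0\<close>. This \<open>\<chi>\<close> is a weight in \<open>S\<^sub>T(x)\<close>
  above \<open>v\<close>.

  The cones follow formally: a linear map commutes with forming rational cones, and the weight cone
  is generated by the union of all orbit monoids.
\<close>

section \<open>Rational cones under linear maps\<close>

lemma rational_cone_image:
  fixes i :: "'v::ab_group_add \<Rightarrow> 'w::ab_group_add"
  assumes "Vector_Spaces.linear sc sc' i"
  shows "i ` rational_cone sc S = rational_cone sc' (i ` S)"
proof -
  interpret Vector_Spaces.linear sc sc' i by fact
  have image_sum: "i (\<Sum>s\<in>F. sc (c s) s) = (\<Sum>s\<in>F. sc' (c s) (i s))" for F c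
    by (simp add: sum scale)
  show ?thesis
  proof (intro equalityI subsetI)
    fix y assume "y \<in> i ` rational_cone sc S"
    then obtain F c where F: "finite F" "F \<subseteq> S" "\<forall>s\<in>F. (0::rat) \<le> c s"
      and y: "y = i (\<Sum>s\<in>F. sc (c s) s)"
      unfolding rational_cone_def by blast
    \<comment> \<open>Generators with the same image contribute the sum of their coefficients.\<close>
    define d where "d w = (\<Sum>s\<in>{s\<in>F. i s = w}. c s)" for w
    have "(\<Sum>w\<in>i ` F. sc' (d w) w) = (\<Sum>w\<in>i ` F. \<Sum>s\<in>{s\<in>F. i s = w}. sc' (c s) (i s))"
      by (intro sum.cong refl) (simp add: d_def vs2.scale_sum_left)
    also have "\<dots> = (\<Sum>s\<in>F. sc' (c s) (i s))"
      using F(1) by (intro sum.group) auto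
    finally have "y = (\<Sum>w\<in>i ` F. sc' (d w) w)"
      using y image_sum by simp
    moreover have "\<forall>w\<in>i ` F. 0 \<le> d w"
      using F(3) by (auto simp: d_def intro!: sum_nonneg)
    ultimately show "y \<in> rational_cone sc' (i ` S)"
      unfolding rational_cone_def using F(1,2)
      by (intro CollectI exI[of _ "i ` F"] exI[of _ d]) auto
  next
    fix y assume "y \<in> rational_cone sc' (i ` S)"
    then obtain F c where F: "finite F" "F \<subseteq> i ` S" "\<forall>s\<in>F. (0::rat) \<le> c s"
      and y: "y = (\<Sum>w\<in>F. sc' (c w) w)"
      unfolding rational_cone_def by blast
    obtain G where G: "G \<subseteq> S" "finite G" "F = i ` G" "inj_on i G"
      using F(1,2) by (metis finite_image_iff subset_image_inj)
    have "y = i (\<Sum>s\<in>G. sc (c (i s)) s)"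
      unfolding y image_sum G(3) by (simp add: sum.reindex[OF G(4)])
    moreover have "(\<Sum>s\<in>G. sc (c (i s)) s) \<in> rational_cone sc S"
      unfolding rational_cone_def using F(3) G(1,2,3)
      by (intro CollectI exI[of _ G] exI[of _ "\<lambda>s. c (i s)"]) auto
    ultimately show "y \<in> i ` rational_cone sc S" by blast
  qed
qed

section \<open>Linear independence of characters\<close>

lemma character_mult:
  assumes "\<chi> \<in> hom G complex_units" "s \<in> carrier G" "t \<in> carrier G"
  shows "\<chi> (s \<otimes>\<^bsub>G\<^esub> t) = \<chi> s * \<chi> t"
  using hom_mult[OF assms] by (simp add: complex_units_def)

lemma character_nonzero:
  assumes "\<chi> \<in> hom G complex_units" "t \<in> carrier G"
  shows "\<chi> t \<noteq> 0"
  using hom_in_carrier[OF assms] by (simp add: complex_units_def)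

lemma characterI:
  assumes "\<And>t. t \<in> carrier G \<Longrightarrow> \<chi> t \<noteq> 0"
    and "\<And>s t. s \<in> carrier G \<Longrightarrow> t \<in> carrier G \<Longrightarrow> \<chi> (s \<otimes>\<^bsub>G\<^esub> t) = \<chi> s * \<chi> t"
  shows "\<chi> \<in> hom G complex_units"
  using assms by (auto simp: hom_def complex_units_def)

text \<open>
  Artin's argument. Subtracting \<open>\<psi>(s)\<close> times a relation at \<open>t\<close> from the relation at \<open>s t\<close> removes
  the term of \<open>\<psi>\<close> and multiplies the coefficient of every other \<open>\<chi>\<close> by \<open>\<chi>(s) - \<psi>(s)\<close>, which is
  nonzero for a suitable \<open>s\<close>.
\<close>

lemma characters_independent:
  fixes b :: "('t \<Rightarrow> complex) \<Rightarrow> complex"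
  assumes "monoid G" "finite C" "C \<subseteq> hom G complex_units \<inter> extensional (carrier G)"
    and "\<And>t. t \<in> carrier G \<Longrightarrow> (\<Sum>\<chi>\<in>C. b \<chi> * \<chi> t) = 0"
    and "\<chi> \<in> C"
  shows "b \<chi> = 0"
  using assms(2-)
proof (induction C arbitrary: b \<chi> rule: finite_induct)
  case empty
  then show ?case by simp
next
  case (insert \<psi> C)
  interpret monoid G by fact
  have C: "C \<subseteq> hom G complex_units \<inter> extensional (carrier G)"
    and \<psi>: "\<psi> \<in> hom G complex_units" "\<psi> \<in> extensional (carrier G)"
    using insert.prems by auto
  have relation: "b \<psi> * \<psi> t + (\<Sum>\<chi>\<in>C. b \<chi> * \<chi> t) = 0" if "t \<in> carrier G" for t
    using insert.prems(2)[OF that] insert.hyps by simp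
  have twisted: "b \<chi> * (\<chi> s - \<psi> s) = 0" if s: "s \<in> carrier G" and "\<chi> \<in> C" for s \<chi>
  proof (rule insert.IH[OF C, where b = "\<lambda>\<chi>. b \<chi> * (\<chi> s - \<psi> s)"])
    fix t assume t: "t \<in> carrier G"
    have "(\<Sum>\<chi>\<in>C. b \<chi> * \<chi> (s \<otimes>\<^bsub>G\<^esub> t)) = (\<Sum>\<chi>\<in>C. b \<chi> * \<chi> s * \<chi> t)"
      using C by (intro sum.cong refl) (auto simp: character_mult s t)
    moreover have "b \<psi> * (\<psi> s * \<psi> t) + (\<Sum>\<chi>\<in>C. b \<chi> * \<chi> (s \<otimes>\<^bsub>G\<^esub> t)) = 0"
      using relation[of "s \<otimes>\<^bsub>G\<^esub> t"] s t by (simp add: character_mult[OF \<psi>(1)])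
    moreover have "b \<psi> * (\<psi> s * \<psi> t) + (\<Sum>\<chi>\<in>C. b \<chi> * \<chi> t) * \<psi> s = 0"
      using arg_cong[OF relation[OF t], of "\<lambda>z. z * \<psi> s"] by (simp add: algebra_simps)
    ultimately have "(\<Sum>\<chi>\<in>C. b \<chi> * \<chi> s * \<chi> t) = (\<Sum>\<chi>\<in>C. b \<chi> * \<chi> t) * \<psi> s"
      by (metis add_left_cancel)
    then show "(\<Sum>\<chi>\<in>C. b \<chi> * (\<chi> s - \<psi> s) * \<chi> t) = 0"
      by (simp add: algebra_simps sum_subtractf sum_distrib_left)
  qed (fact that)
  have rest: "b \<chi> = 0" if "\<chi> \<in> C" for \<chi>
  proof -
    have "\<chi> \<noteq> \<psi>" "\<chi> \<in> extensional (carrier G)" using that insert.hyps C by auto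
    then obtain s where "s \<in> carrier G" "\<chi> s \<noteq> \<psi> s"
      using \<psi>(2) by (meson extensionalityI)
    with twisted[of s \<chi>] that show ?thesis by simp
  qed
  moreover have "b \<psi> = 0"
    using relation[of "\<one>\<^bsub>G\<^esub>"] rest character_nonzero[OF \<psi>(1), of "\<one>\<^bsub>G\<^esub>"] by simp
  ultimately show ?case using insert.prems(3) by auto
qed

section \<open>Finite sums spanning a generated algebra\<close>

definition is_sum_of :: "('y \<Rightarrow> complex) set \<Rightarrow> 'y set \<Rightarrow> ('y \<Rightarrow> complex) \<Rightarrow> bool" where
  "is_sum_of D Y h \<longleftrightarrow> (\<exists>ds. set ds \<subseteq> D \<and> (\<forall>y\<in>Y. h y = (\<Sum>d\<leftarrow>ds. d y)))"

lemma is_sum_of_single: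
  assumes "d \<in> D" "\<And>y. y \<in> Y \<Longrightarrow> h y = d y"
  shows "is_sum_of D Y h"
  unfolding is_sum_of_def using assms by (intro exI[of _ "[d]"]) simp

lemma is_sum_of_add:
  assumes "is_sum_of D Y g" "is_sum_of D Y h"
  shows "is_sum_of D Y (\<lambda>y\<in>Y. g y + h y)"
proof -
  obtain ds es where "set ds \<subseteq> D" "\<forall>y\<in>Y. g y = (\<Sum>d\<leftarrow>ds. d y)"
    "set es \<subseteq> D" "\<forall>y\<in>Y. h y = (\<Sum>d\<leftarrow>es. d y)"
    using assms unfolding is_sum_of_def by blast
  then show ?thesis
    unfolding is_sum_of_def by (intro exI[of _ "ds @ es"]) auto
qed

lemma is_sum_of_mult:
  assumes "is_sum_of D Y g" "is_sum_of D Y h"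
    and mult: "\<And>d e. d \<in> D \<Longrightarrow> e \<in> D \<Longrightarrow> \<exists>k\<in>D. \<forall>y\<in>Y. k y = d y * e y"
  shows "is_sum_of D Y (\<lambda>y\<in>Y. g y * h y)"
proof -
  obtain ds es where ds: "set ds \<subseteq> D" "\<forall>y\<in>Y. g y = (\<Sum>d\<leftarrow>ds. d y)"
    and es: "set es \<subseteq> D" "\<forall>y\<in>Y. h y = (\<Sum>d\<leftarrow>es. d y)"
    using assms(1,2) unfolding is_sum_of_def by blast
  obtain m where m: "\<And>d e. d \<in> D \<Longrightarrow> e \<in> D \<Longrightarrow> m d e \<in> D \<and> (\<forall>y\<in>Y. m d e y = d y * e y)"
    using mult by metis
  have row: "(\<Sum>e\<leftarrow>es. m d e y) = d y * (\<Sum>e\<leftarrow>es. e y)" if "d \<in> D" "y \<in> Y" for d y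
    using es(1) that by (induction es) (auto simp: m algebra_simps)
  have "(\<Sum>k\<leftarrow>concat (map (\<lambda>d. map (m d) es) ds). k y) = (\<Sum>d\<leftarrow>ds. d y) * (\<Sum>e\<leftarrow>es. e y)"
    if "y \<in> Y" for y
    using ds(1) by (induction ds) (auto simp: row that o_def algebra_simps)
  then show ?thesis
    unfolding is_sum_of_def using ds es m
    by (intro exI[of _ "concat (map (\<lambda>d. map (m d) es) ds)"]) (auto 0 3)
qed

text \<open>
  If a set of functions contains the constants and is closed under products, then its finite sums
  form an algebra, which therefore contains whatever is generated by elements of it.
\<close>

lemma generated_algebra_is_sum_of:
  assumes h: "h \<in> generated_algebra Y F"
    and const: "\<And>c. \<exists>k\<in>D. \<forall>y\<in>Y. k y = c"
    and mult: "\<And>d e. d \<in> D \<Longrightarrow> e \<in> D \<Longrightarrow> \<exists>k\<in>D. \<forall>y\<in>Y. k y = d y * e y"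
    and gen: "\<And>f. f \<in> F \<Longrightarrow> is_sum_of D Y f"
  shows "is_sum_of D Y h"
  using h
proof induction
  case (const c)
  then show ?case using assms(2)[of c] by (auto intro: is_sum_of_single)
next
  case (gen f)
  then show ?case using assms(4)[of f] by (simp add: is_sum_of_def)
next
  case (add f g)
  then show ?case by (intro is_sum_of_add)
next
  case (mult f g)
  then show ?case using assms(3) by (intro is_sum_of_mult)
qed

lemma generated_algebra_extensional:
  "h \<in> generated_algebra Y F \<Longrightarrow> h \<in> extensional Y"
  by (induction rule: generated_algebra.induct) (auto simp: extensional_def)

section \<open>Regular functions on a torus as sums of characters\<close>

lemma carrier_std_torus: "carrier (std_torus n) = (\<Pi>\<^sub>E i\<in>{..<n}. UNIV - {0})"
  by (simp add: std_torus_def complex_units_def)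

lemma mult_std_torus: "s \<otimes>\<^bsub>std_torus n\<^esub> t = (\<lambda>i\<in>{..<n}. s i * t i)"
  by (simp add: std_torus_def complex_units_def)

lemma std_torus_nonzero: "t \<in> carrier (std_torus n) \<Longrightarrow> i < n \<Longrightarrow> t i \<noteq> 0"
  by (auto simp: carrier_std_torus)

lemma group_complex_units: "group complex_units"
proof (rule groupI)
  fix x assume "x \<in> carrier complex_units"
  then show "\<exists>y\<in>carrier complex_units. y \<otimes>\<^bsub>complex_units\<^esub> x = \<one>\<^bsub>complex_units\<^esub>"
    by (intro bexI[of _ "inverse x"]) (auto simp: complex_units_def)
qed (auto simp: complex_units_def)

lemma group_std_torus: "group (std_torus n)"
  unfolding std_torus_def by (simp add: group_complex_units)

lemma laurent_polynomial_sum_of_characters: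
  assumes "p \<in> laurent_polynomials n"
  shows "is_sum_of {\<lambda>t. c * \<chi> t |c \<chi>. \<chi> \<in> characters (std_torus n) (laurent_polynomials n)}
    (carrier (std_torus n)) p" (is "is_sum_of ?D ?S p")
proof (rule generated_algebra_is_sum_of)
  let ?L = "laurent_polynomials n"
  show "p \<in> generated_algebra ?S ((\<lambda>i t. t i) ` {..<n} \<union> (\<lambda>i t. inverse (t i)) ` {..<n})"
    using assms by (simp add: laurent_polynomials_def)
  interpret group "std_torus n" by (rule group_std_torus)
  show "\<exists>k\<in>?D. \<forall>y\<in>?S. k y = c" for c
  proof -
    have "(\<lambda>t\<in>?S. 1) \<in> characters (std_torus n) ?L"
      unfolding characters_def laurent_polynomials_def
      by (auto intro!: characterI generated_algebra.const)
    then have "(\<lambda>t. c * (\<lambda>t\<in>?S. 1) t) \<in> ?D" by blast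
    then show ?thesis by (rule bexI[rotated]) simp
  qed
  show "\<exists>k\<in>?D. \<forall>y\<in>?S. k y = d y * e y" if "d \<in> ?D" "e \<in> ?D" for d e
  proof -
    obtain a \<chi> where
      d: "d = (\<lambda>t. a * \<chi> t)" "\<chi> \<in> hom (std_torus n) complex_units" "\<chi> \<in> ?L"
      using \<open>d \<in> ?D\<close> by (auto simp: characters_def)
    obtain b \<psi> where
      e: "e = (\<lambda>t. b * \<psi> t)" "\<psi> \<in> hom (std_torus n) complex_units" "\<psi> \<in> ?L"
      using \<open>e \<in> ?D\<close> by (auto simp: characters_def)
    have "(\<lambda>t\<in>?S. \<chi> t * \<psi> t) \<in> ?L"
      using d(3) e(3) unfolding laurent_polynomials_def by (rule generated_algebra.mult)
    moreover have "(\<lambda>t\<in>?S. \<chi> t * \<psi> t) \<in> hom (std_torus n) complex_units"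
      using d(2) e(2) by (intro characterI) (simp_all add: character_nonzero character_mult)
    ultimately have "(\<lambda>t. (a * b) * (\<lambda>t\<in>?S. \<chi> t * \<psi> t) t) \<in> ?D"
      unfolding characters_def by blast
    then show ?thesis by (rule bexI[rotated]) (simp add: d(1) e(1))
  qed
  fix f :: "(nat \<Rightarrow> complex) \<Rightarrow> complex"
  assume f: "f \<in> (\<lambda>i t. t i) ` {..<n} \<union> (\<lambda>i t. inverse (t i)) ` {..<n}"
  then have "restrict f ?S \<in> ?L"
    unfolding laurent_polynomials_def by (rule generated_algebra.gen)
  moreover have "restrict f ?S \<in> hom (std_torus n) complex_units"
  proof (rule characterI)
    fix t assume t: "t \<in> ?S"
    then show "restrict f ?S t \<noteq> 0"
      using f std_torus_nonzero[OF t] by auto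
    fix s assume s: "s \<in> ?S"
    have "f (s \<otimes>\<^bsub>std_torus n\<^esub> t) = f s * f t"
      using f by (auto simp: mult_std_torus)
    then show "restrict f ?S (s \<otimes>\<^bsub>std_torus n\<^esub> t) = restrict f ?S s * restrict f ?S t"
      using s t by simp
  qed
  ultimately have "(\<lambda>t. 1 * restrict f ?S t) \<in> ?D" unfolding characters_def by blast
  then show "is_sum_of ?D ?S f" by (rule is_sum_of_single) simp
qed

text \<open>
  Pulling back along \<open>\<phi>\<close> is injective on the functions that are extensional on \<open>carrier T\<close>, so
  regularity can be tested on the standard torus, also for functions not yet known to lie in \<open>R\<close>.
\<close>

lemma torus_coordinates:
  assumes "torus T R"
  obtains n \<phi> where "\<phi> \<in> iso (std_torus n) T"
    and "\<And>g. g \<in> extensional (carrier T) \<Longrightarrow>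
           g \<in> R \<longleftrightarrow> compose (carrier (std_torus n)) g \<phi> \<in> laurent_polynomials n"
proof -
  obtain n \<phi> where R: "R \<subseteq> extensional (carrier T)" and \<phi>: "\<phi> \<in> iso (std_torus n) T"
    and L: "(\<lambda>g. compose (carrier (std_torus n)) g \<phi>) ` R = laurent_polynomials n"
    using assms unfolding torus_def by blast
  let ?S = "carrier (std_torus n)"
  have surj: "\<phi> ` ?S = carrier T"
    using \<phi> by (auto simp: iso_def bij_betw_def)
  have "g \<in> R"
    if g: "g \<in> extensional (carrier T)" and gL: "compose ?S g \<phi> \<in> laurent_polynomials n" for g
  proof -
    obtain r where r: "r \<in> R" "compose ?S g \<phi> = compose ?S r \<phi>"
      using gL unfolding L[symmetric] by blast
    have "g (\<phi> s) = r (\<phi> s)" if "s \<in> ?S" for s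
      using fun_cong[OF r(2), of s] that by (simp add: compose_def)
    then have "g t = r t" if "t \<in> carrier T" for t
      using that unfolding surj[symmetric] by blast
    then have "g = r"
      using g R r(1) by (intro extensionalityI[of g "carrier T" r]) auto
    with r(1) show ?thesis by simp
  qed
  then show thesis using L that[OF \<phi>] by blast
qed

lemma regular_function_sum_of_characters:
  assumes "torus T R" "r \<in> R"
  shows "is_sum_of {\<lambda>t. c * \<chi> t |c \<chi>. \<chi> \<in> characters T R} (carrier T) r"
proof -
  obtain n \<phi> where \<phi>: "\<phi> \<in> iso (std_torus n) T"
    and R: "\<And>g. g \<in> extensional (carrier T) \<Longrightarrow>
           g \<in> R \<longleftrightarrow> compose (carrier (std_torus n)) g \<phi> \<in> laurent_polynomials n"
    using torus_coordinates[OF assms(1)] by blast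
  let ?S = "carrier (std_torus n)" and ?L = "laurent_polynomials n"
  interpret T: group T using assms(1) by (simp add: torus_def)
  define \<theta> where "\<theta> = inv_into ?S \<phi>"
  have \<theta>: "\<theta> \<in> hom T (std_torus n)"
    using group.iso_set_sym[OF group_std_torus \<phi>] by (simp add: \<theta>_def iso_def)
  have bij: "bij_betw \<phi> ?S (carrier T)" using \<phi> by (simp add: iso_def)
  have \<phi>\<theta>: "\<phi> (\<theta> t) = t" if "t \<in> carrier T" for t
    using bij that by (simp add: \<theta>_def bij_betw_inv_into_right)
  have \<theta>\<phi>: "\<theta> (\<phi> s) = s" if "s \<in> ?S" for s
    using bij that by (simp add: \<theta>_def bij_betw_inv_into_left)
  have \<phi>_in: "\<phi> s \<in> carrier T" if "s \<in> ?S" for s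
    using bij that by (auto simp: bij_betw_def)
  have transport: "compose (carrier T) \<chi> \<theta> \<in> characters T R"
    if "\<chi> \<in> characters (std_torus n) ?L" for \<chi>
  proof -
    have \<chi>: "\<chi> \<in> hom (std_torus n) complex_units" "\<chi> \<in> ?L"
      using that by (auto simp: characters_def)
    have "\<chi> \<in> extensional ?S"
      using \<chi>(2) unfolding laurent_polynomials_def by (rule generated_algebra_extensional)
    then have "compose ?S (compose (carrier T) \<chi> \<theta>) \<phi> = \<chi>"
      by (intro extensionalityI[of _ ?S]) (auto simp: compose_def \<theta>\<phi> \<phi>_in)
    then have "compose (carrier T) \<chi> \<theta> \<in> R"
      using R[of "compose (carrier T) \<chi> \<theta>"] \<chi>(2) by simp
    with T.hom_compose[OF \<theta> \<chi>(1)] show ?thesis by (simp add: characters_def)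
  qed
  have "r \<in> extensional (carrier T)" using assms by (auto simp: torus_def)
  with assms(2) R have "compose ?S r \<phi> \<in> ?L" by blast
  from laurent_polynomial_sum_of_characters[OF this]
  obtain ds where ds: "set ds \<subseteq> {\<lambda>t. c * \<chi> t |c \<chi>. \<chi> \<in> characters (std_torus n) ?L}"
    and sum: "\<forall>s\<in>?S. compose ?S r \<phi> s = (\<Sum>d\<leftarrow>ds. d s)"
    unfolding is_sum_of_def by blast
  have "r t = (\<Sum>d\<leftarrow>map (\<lambda>d. compose (carrier T) d \<theta>) ds. d t)" if t: "t \<in> carrier T" for t
  proof -
    have "\<theta> t \<in> ?S" using \<theta> t by (rule hom_in_carrier)
    then have "r t = (\<Sum>d\<leftarrow>ds. d (\<theta> t))"
      using sum by (metis compose_eq \<phi>\<theta> t)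
    then show ?thesis using t by (simp add: compose_def o_def)
  qed
  moreover have "is_sum_of {\<lambda>t. c * \<chi> t |c \<chi>. \<chi> \<in> characters T R} (carrier T)
      (\<lambda>t. \<Sum>d\<leftarrow>map (\<lambda>d. compose (carrier T) d \<theta>) ds. d t)"
    using ds
  proof (induction ds)
    case Nil
    then show ?case unfolding is_sum_of_def by (intro exI[of _ "[]"]) simp
  next
    case (Cons d ds)
    let ?D = "{\<lambda>t. c * \<chi> t |c \<chi>. \<chi> \<in> characters T R}"
    obtain c \<chi> where d: "d = (\<lambda>s. c * \<chi> s)" "\<chi> \<in> characters (std_torus n) ?L"
      using Cons.prems by auto
    have "(\<lambda>t. c * compose (carrier T) \<chi> \<theta> t) \<in> ?D" using transport[OF d(2)] by blast
    then have "is_sum_of ?D (carrier T) (compose (carrier T) d \<theta>)"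
      by (rule is_sum_of_single) (simp add: d(1) compose_def)
    from is_sum_of_add[OF this Cons.IH] Cons.prems show ?case
      by (simp add: is_sum_of_def)
  qed
  ultimately show ?thesis by (simp add: is_sum_of_def)
qed

lemma characters_mult:
  assumes "torus T R" "\<chi> \<in> characters T R" "\<psi> \<in> characters T R"
  shows "(\<lambda>t\<in>carrier T. \<chi> t * \<psi> t) \<in> characters T R"
proof -
  obtain n \<phi> where \<phi>: "\<phi> \<in> iso (std_torus n) T"
    and R: "\<And>g. g \<in> extensional (carrier T) \<Longrightarrow>
           g \<in> R \<longleftrightarrow> compose (carrier (std_torus n)) g \<phi> \<in> laurent_polynomials n"
    using torus_coordinates[OF assms(1)] by blast
  let ?S = "carrier (std_torus n)"
  interpret T: group T using assms(1) by (simp add: torus_def)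
  have hom: "\<chi> \<in> hom T complex_units" "\<psi> \<in> hom T complex_units"
    using assms by (auto simp: characters_def)
  have in_T: "\<phi> s \<in> carrier T" if "s \<in> ?S" for s
    using \<phi> that by (auto simp: iso_def bij_betw_def)
  have "\<chi> \<in> R" "\<psi> \<in> R" "R \<subseteq> extensional (carrier T)"
    using assms by (auto simp: characters_def torus_def)
  then have "compose ?S \<chi> \<phi> \<in> laurent_polynomials n" "compose ?S \<psi> \<phi> \<in> laurent_polynomials n"
    using R by blast+
  then have "(\<lambda>s\<in>?S. compose ?S \<chi> \<phi> s * compose ?S \<psi> \<phi> s) \<in> laurent_polynomials n"
    unfolding laurent_polynomials_def by (rule generated_algebra.mult)
  also have "(\<lambda>s\<in>?S. compose ?S \<chi> \<phi> s * compose ?S \<psi> \<phi> s)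
      = compose ?S (\<lambda>t\<in>carrier T. \<chi> t * \<psi> t) \<phi>"
    by (auto simp: compose_def in_T intro!: restrict_ext)
  finally have "(\<lambda>t\<in>carrier T. \<chi> t * \<psi> t) \<in> R" using R by auto
  moreover have "(\<lambda>t\<in>carrier T. \<chi> t * \<psi> t) \<in> hom T complex_units"
    using hom by (intro characterI) (simp_all add: character_nonzero character_mult)
  ultimately show ?thesis by (simp add: characters_def)
qed

lemma trivial_character:
  assumes "torus T R"
  shows "(\<lambda>t\<in>carrier T. 1) \<in> characters T R"
proof -
  obtain n \<phi> where \<phi>: "\<phi> \<in> iso (std_torus n) T"
    and R: "\<And>g. g \<in> extensional (carrier T) \<Longrightarrow>
           g \<in> R \<longleftrightarrow> compose (carrier (std_torus n)) g \<phi> \<in> laurent_polynomials n"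
    using torus_coordinates[OF assms(1)] by blast
  let ?S = "carrier (std_torus n)"
  interpret T: group T using assms(1) by (simp add: torus_def)
  have "compose ?S (\<lambda>t\<in>carrier T. 1 :: complex) \<phi> = (\<lambda>s\<in>?S. 1)"
    using \<phi> by (auto simp: compose_def iso_def bij_betw_def intro!: restrict_ext)
  then have "compose ?S (\<lambda>t\<in>carrier T. 1) \<phi> \<in> laurent_polynomials n"
    unfolding laurent_polynomials_def by (simp only: generated_algebra.const)
  then have "(\<lambda>t\<in>carrier T. 1) \<in> R" using R by auto
  moreover have "(\<lambda>t\<in>carrier T. 1) \<in> hom T complex_units" by (intro characterI) auto
  ultimately show ?thesis by (simp add: characters_def)
qed

text \<open>
  The pure tensors of a character with an element of \<open>A\<close> are closed under products, because
  characters multiply to characters, and their finite sums contain both kinds of generators.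
\<close>

lemma product_algebra_sum_of_characters:
  assumes T: "torus T R" and A: "A = generated_algebra X F"
    and h: "h \<in> product_algebra (carrier T) R X A"
  shows "is_sum_of {\<lambda>(t, x). \<chi> t * a x |\<chi> a. \<chi> \<in> characters T R \<and> a \<in> A} (carrier T \<times> X) h"
    (is "is_sum_of ?D ?Y h")
proof (rule generated_algebra_is_sum_of)
  show "h \<in> generated_algebra ?Y ((\<lambda>f. f \<circ> fst) ` R \<union> (\<lambda>g. g \<circ> snd) ` A)"
    using h by (simp add: product_algebra_def)
  have const: "(\<lambda>x\<in>X. c) \<in> A" for c by (simp add: A generated_algebra.const)
  show "\<exists>k\<in>?D. \<forall>y\<in>?Y. k y = c" for c
  proof -
    have "(\<lambda>(t, x). (\<lambda>t\<in>carrier T. 1) t * (\<lambda>x\<in>X. c) x) \<in> ?D"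
      using trivial_character[OF T] const by blast
    then show ?thesis by (rule bexI[rotated]) auto
  qed
  show "\<exists>k\<in>?D. \<forall>y\<in>?Y. k y = d y * e y" if "d \<in> ?D" "e \<in> ?D" for d e
  proof -
    obtain \<chi> a where d: "d = (\<lambda>(t, x). \<chi> t * a x)" "\<chi> \<in> characters T R" "a \<in> A"
      using \<open>d \<in> ?D\<close> by auto
    obtain \<psi> b where e: "e = (\<lambda>(t, x). \<psi> t * b x)" "\<psi> \<in> characters T R" "b \<in> A"
      using \<open>e \<in> ?D\<close> by auto
    have "(\<lambda>x\<in>X. a x * b x) \<in> A"
      using d(3) e(3) unfolding A by (rule generated_algebra.mult)
    with characters_mult[OF T d(2) e(2)]
    have "(\<lambda>(t, x). (\<lambda>t\<in>carrier T. \<chi> t * \<psi> t) t * (\<lambda>x\<in>X. a x * b x) x) \<in> ?D" by blast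
    then show ?thesis by (rule bexI[rotated]) (auto simp: d(1) e(1))
  qed
  fix f :: "_ \<Rightarrow> complex"
  assume "f \<in> (\<lambda>f. f \<circ> fst) ` R \<union> (\<lambda>g. g \<circ> snd) ` A"
  then consider r where "r \<in> R" "f = r \<circ> fst" | a where "a \<in> A" "f = a \<circ> snd" by blast
  then show "is_sum_of ?D ?Y f"
  proof cases
    case 1
    obtain ds where ds: "set ds \<subseteq> {\<lambda>t. c * \<chi> t |c \<chi>. \<chi> \<in> characters T R}"
      and sum: "\<forall>t\<in>carrier T. r t = (\<Sum>d\<leftarrow>ds. d t)"
      using regular_function_sum_of_characters[OF T 1(1)] unfolding is_sum_of_def by blast
    have "is_sum_of ?D ?Y (\<lambda>y. \<Sum>d\<leftarrow>ds. d (fst y))"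
      using ds
    proof (induction ds)
      case Nil
      then show ?case unfolding is_sum_of_def by (intro exI[of _ "[]"]) simp
    next
      case (Cons d ds)
      obtain c \<chi> where d: "d = (\<lambda>s. c * \<chi> s)" "\<chi> \<in> characters T R"
        using Cons.prems by auto
      have "(\<lambda>(t, x). \<chi> t * (\<lambda>x\<in>X. c) x) \<in> ?D" using d(2) const by blast
      then have "is_sum_of ?D ?Y (\<lambda>y. d (fst y))"
        by (rule is_sum_of_single) (auto simp: d(1))
      from is_sum_of_add[OF this Cons.IH] Cons.prems show ?case
        by (simp add: is_sum_of_def)
    qed
    with sum show ?thesis by (simp add: is_sum_of_def 1(2))
  next
    case 2
    have "(\<lambda>(t, x). (\<lambda>t\<in>carrier T. 1) t * a x) \<in> ?D"
      using trivial_character[OF T] 2(1) by blast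
    then show ?thesis by (rule is_sum_of_single) (auto simp: 2(2))
  qed
qed

section \<open>Homogeneous components of a regular function\<close>

text \<open>
  Linear independence concerns distinct characters, so terms with the same character are merged
  before it is applied.
\<close>

lemma collect_character_coefficients:
  assumes A: "A = generated_algebra X F"
    and h: "is_sum_of {\<lambda>(t, x). \<chi> t * a x |\<chi> a. \<chi> \<in> K \<and> a \<in> A} (S \<times> X) h"
  obtains C a where "finite C" "C \<subseteq> K" "\<And>\<chi>. a \<chi> \<in> A"
    "\<And>t x. t \<in> S \<Longrightarrow> x \<in> X \<Longrightarrow> h (t, x) = (\<Sum>\<chi>\<in>C. \<chi> t * a \<chi> x)"
proof -
  obtain ds where ds: "set ds \<subseteq> {\<lambda>(t, x). \<chi> t * a x |\<chi> a. \<chi> \<in> K \<and> a \<in> A}"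
    and sum: "\<forall>y\<in>S \<times> X. h y = (\<Sum>d\<leftarrow>ds. d y)"
    using h unfolding is_sum_of_def by blast
  have "\<exists>C a. finite C \<and> C \<subseteq> K \<and> (\<forall>\<chi>. a \<chi> \<in> A) \<and>
      (\<forall>t\<in>S. \<forall>x\<in>X. (\<Sum>d\<leftarrow>ds. d (t, x)) = (\<Sum>\<chi>\<in>C. \<chi> t * a \<chi> x))"
    using ds
  proof (induction ds)
    case Nil
    have "(\<lambda>x\<in>X. 0) \<in> A" by (simp add: A generated_algebra.const)
    then show ?case by (intro exI[of _ "{}"] exI[of _ "\<lambda>_. \<lambda>x\<in>X. 0"])
        (auto simp del: restrict_apply)
  next
    case (Cons d ds)
    obtain C a where C: "finite C" "C \<subseteq> K" and a: "\<forall>\<chi>. a \<chi> \<in> A"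
      and IH: "\<forall>t\<in>S. \<forall>x\<in>X. (\<Sum>d\<leftarrow>ds. d (t, x)) = (\<Sum>\<chi>\<in>C. \<chi> t * a \<chi> x)"
      using Cons by auto
    obtain \<psi> b where d: "d = (\<lambda>(t, x). \<psi> t * b x)" "\<psi> \<in> K" "b \<in> A"
      using Cons.prems by auto
    \<comment> \<open>Off \<open>C\<close> the coefficients \<open>a\<close> are arbitrary, so a new character has to start from \<open>0\<close>.\<close>
    define a' where
      "a' = a(\<psi> := (\<lambda>x\<in>X. (if \<psi> \<in> C then a \<psi> else (\<lambda>x\<in>X. 0)) x + b x))"
    have "(if \<psi> \<in> C then a \<psi> else (\<lambda>x\<in>X. 0)) \<in> A"
      using a by (simp add: A generated_algebra.const)
    then have "(\<lambda>x\<in>X. (if \<psi> \<in> C then a \<psi> else (\<lambda>x\<in>X. 0)) x + b x) \<in> A"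
      using d(3) unfolding A by (rule generated_algebra.add)
    then have "\<forall>\<chi>. a' \<chi> \<in> A" using a unfolding a'_def by auto
    moreover have "(\<Sum>d\<leftarrow>d # ds. d (t, x)) = (\<Sum>\<chi>\<in>insert \<psi> C. \<chi> t * a' \<chi> x)"
      if "t \<in> S" "x \<in> X" for t x
    proof -
      have rest: "(\<Sum>\<chi>\<in>C - {\<psi>}. \<chi> t * a' \<chi> x) = (\<Sum>\<chi>\<in>C - {\<psi>}. \<chi> t * a \<chi> x)"
        by (intro sum.cong) (auto simp: a'_def)
      have "(\<Sum>\<chi>\<in>C. \<chi> t * a \<chi> x)
          = (if \<psi> \<in> C then \<psi> t * a \<psi> x else 0) + (\<Sum>\<chi>\<in>C - {\<psi>}. \<chi> t * a \<chi> x)"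
        using C(1) by (simp add: sum.remove)
      then show ?thesis
        using C(1) IH that
        by (simp add: sum.insert_remove rest d(1)) (simp add: a'_def algebra_simps)
    qed
    ultimately show ?case
      using C d(2) by (intro exI[of _ "insert \<psi> C"] exI[of _ a']) auto
  qed
  then obtain C a where "finite C" "C \<subseteq> K" "\<forall>\<chi>. a \<chi> \<in> A"
    and "\<forall>t\<in>S. \<forall>x\<in>X. (\<Sum>d\<leftarrow>ds. d (t, x)) = (\<Sum>\<chi>\<in>C. \<chi> t * a \<chi> x)"
    by blast
  with sum show thesis by (intro that[of C a]) auto
qed

text \<open>
  Comparing the expansions of \<open>f((s t) x)\<close> and of \<open>f(s (t x))\<close> as functions of \<open>s\<close> gives two
  linear combinations of the same characters; by independence their coefficients agree, which is
  homogeneity.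
\<close>

lemma homogeneous_expansion:
  assumes T: "torus T R" and A: "A = generated_algebra X F"
    and act: "regular_action T R X A \<alpha>" and f: "f \<in> A"
  obtains C a where "finite C" "C \<subseteq> characters T R"
    "\<And>\<chi>. \<chi> \<in> C \<Longrightarrow> a \<chi> \<in> weight_space T X A \<alpha> \<chi>"
    "\<And>t x. t \<in> carrier T \<Longrightarrow> x \<in> X \<Longrightarrow> f (\<alpha> t x) = (\<Sum>\<chi>\<in>C. \<chi> t * a \<chi> x)"
proof -
  interpret T: group T using T by (simp add: torus_def)
  interpret action: group_action T X \<alpha> using act by (simp add: regular_action_def)
  have "compose (carrier T \<times> X) f (\<lambda>(t, x). \<alpha> t x) \<in> product_algebra (carrier T) R X A"
    using act f by (auto simp: regular_action_def regular_map_def)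
  from product_algebra_sum_of_characters[OF T A this]
  obtain C a where C: "finite C" "C \<subseteq> characters T R" and aA: "\<And>\<chi>. a \<chi> \<in> A"
    and sum: "\<And>t x. t \<in> carrier T \<Longrightarrow> x \<in> X \<Longrightarrow>
      compose (carrier T \<times> X) f (\<lambda>(t, x). \<alpha> t x) (t, x) = (\<Sum>\<chi>\<in>C. \<chi> t * a \<chi> x)"
    using collect_character_coefficients[OF A] by blast
  have exp: "f (\<alpha> t x) = (\<Sum>\<chi>\<in>C. \<chi> t * a \<chi> x)" if "t \<in> carrier T" "x \<in> X" for t x
    using sum[OF that] that by (simp add: compose_def)
  have Chom: "C \<subseteq> hom T complex_units \<inter> extensional (carrier T)"
    using C(2) T by (auto simp: characters_def torus_def)
  have "a \<chi> (\<alpha> t x) = \<chi> t * a \<chi> x"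
    if \<chi>: "\<chi> \<in> C" and t: "t \<in> carrier T" and x: "x \<in> X" for \<chi> t x
  proof -
    have tx: "\<alpha> t x \<in> X" using t x action.element_image by blast
    have "(\<Sum>\<chi>\<in>C. (a \<chi> (\<alpha> t x) - \<chi> t * a \<chi> x) * \<chi> s) = 0" if s: "s \<in> carrier T" for s
    proof -
      have "(\<Sum>\<chi>\<in>C. \<chi> s * a \<chi> (\<alpha> t x)) = f (\<alpha> (s \<otimes>\<^bsub>T\<^esub> t) x)"
        by (simp add: exp[OF s tx] action.composition_rule[OF x s t])
      also have "\<dots> = (\<Sum>\<chi>\<in>C. \<chi> (s \<otimes>\<^bsub>T\<^esub> t) * a \<chi> x)"
        using s t x by (intro exp) auto
      also have "\<dots> = (\<Sum>\<chi>\<in>C. \<chi> s * \<chi> t * a \<chi> x)"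
        using Chom by (intro sum.cong refl) (auto simp: character_mult s t)
      finally show ?thesis by (simp add: algebra_simps sum_subtractf)
    qed
    from characters_independent[OF T.is_monoid C(1) Chom this \<chi>] show ?thesis by simp
  qed
  then have "a \<chi> \<in> weight_space T X A \<alpha> \<chi>" if "\<chi> \<in> C" for \<chi>
    using aA that by (simp add: weight_space_def)
  with C exp that show thesis by blast
qed

section \<open>Passing to a subgroup\<close>

lemma weight_space_restrict:
  assumes "H \<subseteq> carrier T" "f \<in> weight_space T X A \<alpha> \<chi>"
  shows "f \<in> weight_space (T\<lparr>carrier := H\<rparr>) X A \<alpha> (restrict \<chi> H)"
  using assms by (auto simp: weight_space_def)

text \<open>
  For fixed \<open>x\<close> the expansion of \<open>f(s x)\<close> over \<open>s \<in> H\<close> equals the single term \<open>\<xi>(s) f(x)\<close>. Grouping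
  it by restrictions to \<open>H\<close> and comparing the coefficients of \<open>\<xi>\<close> shows that the components of \<open>f\<close>
  whose weights restrict to \<open>\<xi>\<close> sum to \<open>f(x) \<noteq> 0\<close> at \<open>x\<close>, so one of them does not vanish there.
\<close>

lemma weight_lifts_at_point:
  assumes T: "torus T R" and A: "A = generated_algebra X F"
    and act: "regular_action T R X A \<alpha>" and H: "subgroup H T"
    and \<xi>: "\<xi> \<in> hom (T\<lparr>carrier := H\<rparr>) complex_units" "\<xi> \<in> extensional H"
    and f: "f \<in> weight_space (T\<lparr>carrier := H\<rparr>) X A \<alpha> \<xi>" and x: "x \<in> X" "f x \<noteq> 0"
  obtains \<chi> g where "\<chi> \<in> characters T R" "restrict \<chi> H = \<xi>"
    "g \<in> weight_space T X A \<alpha> \<chi>" "g x \<noteq> 0"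
proof -
  interpret T: group T using T by (simp add: torus_def)
  interpret H: group "T\<lparr>carrier := H\<rparr>" using H T.is_group by (rule subgroup.subgroup_is_group)
  have HT: "H \<subseteq> carrier T" using H by (rule subgroup.subset)
  have fA: "f \<in> A" using f by (simp add: weight_space_def)
  obtain C a where C: "finite C" "C \<subseteq> characters T R"
    and a: "\<And>\<chi>. \<chi> \<in> C \<Longrightarrow> a \<chi> \<in> weight_space T X A \<alpha> \<chi>"
    and exp: "\<And>t x. t \<in> carrier T \<Longrightarrow> x \<in> X \<Longrightarrow> f (\<alpha> t x) = (\<Sum>\<chi>\<in>C. \<chi> t * a \<chi> x)"
    using homogeneous_expansion[OF T A act fA] by blast
  let ?D = "insert \<xi> ((\<lambda>\<chi>. restrict \<chi> H) ` C)"
  \<comment> \<open>The coefficients of the grouped relation with \<open>\<xi>(s) f(x)\<close> moved to the same side.\<close>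
  define b where
    "b \<eta> = (\<Sum>\<chi>\<in>{\<chi>\<in>C. restrict \<chi> H = \<eta>}. a \<chi> x) - (if \<eta> = \<xi> then f x else 0)" for \<eta>
  have D: "?D \<subseteq> hom (T\<lparr>carrier := H\<rparr>) complex_units \<inter> extensional (carrier (T\<lparr>carrier := H\<rparr>))"
  proof -
    have "restrict \<chi> H \<in> hom (T\<lparr>carrier := H\<rparr>) complex_units" if "\<chi> \<in> C" for \<chi>
    proof -
      have \<chi>: "\<chi> \<in> hom T complex_units" using that C(2) by (auto simp: characters_def)
      show ?thesis
        using HT by (intro characterI)
          (auto simp: character_nonzero[OF \<chi>] character_mult[OF \<chi>]
            subgroup.m_closed[OF H] subset_iff)
    qed
    with \<xi> show ?thesis by auto
  qed
  have "(\<Sum>\<eta>\<in>?D. b \<eta> * \<eta> s) = 0" if "s \<in> carrier (T\<lparr>carrier := H\<rparr>)" for s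
  proof -
    have s: "s \<in> H" using that by simp
    have "(\<Sum>\<eta>\<in>?D. (\<Sum>\<chi>\<in>{\<chi>\<in>C. restrict \<chi> H = \<eta>}. a \<chi> x) * \<eta> s)
        = (\<Sum>\<eta>\<in>?D. \<Sum>\<chi>\<in>{\<chi>\<in>C. restrict \<chi> H = \<eta>}. \<chi> s * a \<chi> x)"
      unfolding sum_distrib_right using s by (intro sum.cong refl) auto
    also have "\<dots> = (\<Sum>\<chi>\<in>C. \<chi> s * a \<chi> x)"
      using C(1) by (intro sum.group) auto
    also have "\<dots> = f (\<alpha> s x)" using exp[of s x] s HT x(1) by auto
    also have "\<dots> = \<xi> s * f x" using f s x(1) by (simp add: weight_space_def)
    also have "\<dots> = (\<Sum>\<eta>\<in>?D. (if \<eta> = \<xi> then f x else 0) * \<eta> s)"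
      using C(1) by (simp add: if_distrib[of "\<lambda>z. z * _"] sum.delta cong: if_cong)
    finally show ?thesis by (simp add: b_def left_diff_distrib sum_subtractf)
  qed
  from characters_independent[OF H.is_monoid _ D this, of \<xi>] C(1) have "b \<xi> = 0" by simp
  then have "(\<Sum>\<chi>\<in>{\<chi>\<in>C. restrict \<chi> H = \<xi>}. a \<chi> x) \<noteq> 0" using x(2) by (simp add: b_def)
  then obtain \<chi> where "\<chi> \<in> C" "restrict \<chi> H = \<xi>" "a \<chi> x \<noteq> 0"
    by (metis (mono_tags, lifting) mem_Collect_eq sum.neutral)
  with that a C(2) show thesis by blast
qed

lemma nonzero_weights_eq_orbit_monoids:
  assumes A: "A = generated_algebra X F"
    and stable: "\<And>t x. t \<in> carrier T \<Longrightarrow> x \<in> X \<Longrightarrow> \<alpha> t x \<in> X"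
  shows "{u \<in> M. weight_space T X A \<alpha> (\<chi> u) \<noteq> {\<lambda>x\<in>X. 0}} = (\<Union>x\<in>X. orbit_monoid M \<chi> T X A \<alpha> x)"
proof -
  have "weight_space T X A \<alpha> \<xi> \<noteq> {\<lambda>x\<in>X. 0} \<longleftrightarrow> (\<exists>x\<in>X. \<exists>f\<in>weight_space T X A \<alpha> \<xi>. f x \<noteq> 0)"
    (is "?W \<noteq> {?z} \<longleftrightarrow> _") for \<xi>
  proof -
    have zero: "?z \<in> ?W"
      using stable by (auto simp: weight_space_def A generated_algebra.const)
    have eq_zero: "f = ?z" if "f \<in> ?W" "\<forall>x\<in>X. f x = 0" for f
    proof -
      have "f \<in> extensional X"
        using that(1) A generated_algebra_extensional by (auto simp: weight_space_def)
      with that(2) show ?thesis by (intro extensionalityI[of f X]) auto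
    qed
    have "f x = 0" if "?W = {?z}" "f \<in> ?W" "x \<in> X" for f x
    proof -
      have "f = ?z" using that(2) unfolding that(1) by (rule singletonD)
      with that(3) show ?thesis by simp
    qed
    moreover have "?W = {?z}" if "\<forall>f\<in>?W. \<forall>x\<in>X. f x = 0"
      using zero eq_zero that by blast
    ultimately show ?thesis by metis
  qed
  then show ?thesis unfolding orbit_monoid_def by blast
qed

theorem proposition1:
  fixes X :: "'x set" and A :: "('x \<Rightarrow> complex) set"
    and T :: "('t, 'b) monoid_scheme" and R :: "('t \<Rightarrow> complex) set"
    and T' :: "'t set"
    and \<alpha> :: "'t \<Rightarrow> 'x \<Rightarrow> 'x"
    and sc :: "rat \<Rightarrow> 'v::ab_group_add \<Rightarrow> 'v" and M :: "'v set" and \<chi> :: "'v \<Rightarrow> 't \<Rightarrow> complex"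
    and sc' :: "rat \<Rightarrow> 'w::ab_group_add \<Rightarrow> 'w" and M' :: "'w set" and \<chi>' :: "'w \<Rightarrow> 't \<Rightarrow> complex"
    and i :: "'v \<Rightarrow> 'w"
  assumes "normal_affine_variety X A"
    and "torus T R" and "character_lattice sc M \<chi> T R"
    and "regular_action T R X A \<alpha>" and "faithful_action T X \<alpha>"
    and "subtorus T' T R"
    and "character_lattice sc' M' \<chi>' (T\<lparr>carrier := T'\<rparr>) (restrict_algebra R T')"
    and "induced_lattice_hom sc M \<chi> sc' M' \<chi>' T' i" and "i ` M = M'"
  shows "i ` weight_cone sc M \<chi> T X A \<alpha> = weight_cone sc' M' \<chi>' (T\<lparr>carrier := T'\<rparr>) X A \<alpha> \<and>
    (\<forall>x\<in>X. i ` orbit_cone sc M \<chi> T X A \<alpha> x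
             = orbit_cone sc' M' \<chi>' (T\<lparr>carrier := T'\<rparr>) X A \<alpha> x) \<and>
    (\<forall>x\<in>X. i ` orbit_monoid M \<chi> T X A \<alpha> x
             = orbit_monoid M' \<chi>' (T\<lparr>carrier := T'\<rparr>) X A \<alpha> x)"
proof -
  obtain F where A: "A = generated_algebra X F"
    using assms(1) by (auto simp: normal_affine_variety_def affine_variety_def)
  have H: "subgroup T' T" using assms(6) by (simp add: subtorus_def)
  then have HT: "T' \<subseteq> carrier T" by (rule subgroup.subset)
  let ?T' = "T\<lparr>carrier := T'\<rparr>" and ?R' = "restrict_algebra R T'"
  have lin: "Vector_Spaces.linear sc sc' i"
    and i_char: "\<And>u. u \<in> M \<Longrightarrow> \<chi>' (i u) = restrict (\<chi> u) T'"
    using assms(8) by (auto simp: induced_lattice_hom_def)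
  have bij: "bij_betw \<chi> M (characters T R)" and bij': "bij_betw \<chi>' M' (characters ?T' ?R')"
    using assms(3,7) by (auto simp: character_lattice_def)
  have monoid: "i ` orbit_monoid M \<chi> T X A \<alpha> x = orbit_monoid M' \<chi>' ?T' X A \<alpha> x"
    if x: "x \<in> X" for x
  proof (intro equalityI subsetI)
    fix v assume "v \<in> i ` orbit_monoid M \<chi> T X A \<alpha> x"
    then obtain u f where u: "u \<in> M" "v = i u" and f: "f \<in> weight_space T X A \<alpha> (\<chi> u)" "f x \<noteq> 0"
      by (auto simp: orbit_monoid_def)
    have "f \<in> weight_space ?T' X A \<alpha> (\<chi>' v)"
      using weight_space_restrict[OF HT f(1)] u i_char by simp
    then show "v \<in> orbit_monoid M' \<chi>' ?T' X A \<alpha> x"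
      using u f(2) assms(9) by (auto simp: orbit_monoid_def)
  next
    fix v assume "v \<in> orbit_monoid M' \<chi>' ?T' X A \<alpha> x"
    then obtain f where v: "v \<in> M'" and f: "f \<in> weight_space ?T' X A \<alpha> (\<chi>' v)" "f x \<noteq> 0"
      by (auto simp: orbit_monoid_def)
    have "\<chi>' v \<in> characters ?T' ?R'" using bij' v by (auto simp: bij_betw_def)
    then have \<chi>'v: "\<chi>' v \<in> hom ?T' complex_units" "\<chi>' v \<in> extensional T'"
      by (auto simp: characters_def restrict_algebra_def)
    obtain \<psi> g where \<psi>: "\<psi> \<in> characters T R" "restrict \<psi> T' = \<chi>' v"
      and g: "g \<in> weight_space T X A \<alpha> \<psi>" "g x \<noteq> 0"
      using weight_lifts_at_point[OF assms(2) A assms(4) H \<chi>'v f(1) x f(2)] .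
    obtain u where u: "u \<in> M" "\<psi> = \<chi> u" using bij \<psi>(1) by (auto simp: bij_betw_def)
    have "\<chi>' (i u) = \<chi>' v" using u \<psi>(2) i_char by simp
    moreover have "i u \<in> M'" using u(1) assms(9) by blast
    ultimately have "v = i u" using bij' v by (auto simp: bij_betw_def dest: inj_onD)
    then show "v \<in> i ` orbit_monoid M \<chi> T X A \<alpha> x"
      using u g by (auto simp: orbit_monoid_def)
  qed
  have "i ` (\<Union>x\<in>X. orbit_monoid M \<chi> T X A \<alpha> x) = (\<Union>x\<in>X. orbit_monoid M' \<chi>' ?T' X A \<alpha> x)"
    by (simp add: image_UN monoid)
  moreover have stable: "\<alpha> t x \<in> X" if "t \<in> carrier T" "x \<in> X" for t x
    using assms(4) that by (meson regular_action_def group_action.element_image)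
  moreover have "\<alpha> t x \<in> X" if "t \<in> carrier ?T'" "x \<in> X" for t x
    using stable that HT by auto
  ultimately have "i ` weight_cone sc M \<chi> T X A \<alpha> = weight_cone sc' M' \<chi>' ?T' X A \<alpha>"
    unfolding weight_cone_def
    by (simp only: rational_cone_image[OF lin] nonzero_weights_eq_orbit_monoids[OF A])
  moreover have "i ` orbit_cone sc M \<chi> T X A \<alpha> x = orbit_cone sc' M' \<chi>' ?T' X A \<alpha> x"
    if "x \<in> X" for x
    unfolding orbit_cone_def rational_cone_image[OF lin] monoid[OF that] ..
  ultimately show ?thesis using monoid by blast
qed

end
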